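(* Let $n,m\ge 0$ be integers and $\alpha\in\mathbb{C}$ with $\operatorname{Re}(\alpha)>0$. Then $$w_{n+m}^{(\alpha)}(x)=\sum_{k=0}^{m}\sum_{j=0}^{n}\genfrac{\{}{\}}{0pt}{}{m}{k}\binom{n}{j}\binom{\alpha+k-1}{k}k!\,k^{\,n-j}\,x^{k}\,w_{j}^{(\alpha+k)}(x)$$ as polynomials in $x$.
   Context: General geometric polynomials: $w_n^{(\alpha)}(x)=\sum_{k=0}^{n}\genfrac{\{}{\}}{0pt}{}{n}{k}\binom{\alpha+k-1}{k}k!\,x^k$, with $\genfrac{\{}{\}}{0pt}{}{n}{k}$ the Stirling numbers of the second kind and $\binom{\alpha+k-1}{k}=\frac{\alpha(\alpha+1)\cdots(\alpha+k-1)}{k!}$. Convention: $0^0=1$. *)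

theory Defs
  imports
    Complex_Main
    "HOL-Combinatorics.Stirling"
    "HOL-Computational_Algebra.Polynomial"
begin

text \<open>
  The capitalised constant \<^const>\<open>Stirling\<close> is the Stirling number of the second kind;
  the lower-case \<^const>\<open>stirling\<close> is the first kind.
\<close>

definition geometric_poly :: "nat \<Rightarrow> complex \<Rightarrow> complex poly" where
  "geometric_poly n \<alpha> =
     (\<Sum>k=0..n. monom (of_nat (Stirling n k) * ((\<alpha> + of_nat k - 1) gchoose k) * fact k) k)"

lemma poly_geometric_poly:
  "poly (geometric_poly n \<alpha>) x =
     (\<Sum>k=0..n. of_nat (Stirling n k) * ((\<alpha> + of_nat k - 1) gchoose k) * fact k * x ^ k)"
  by (simp add: geometric_poly_def poly_sum poly_monom)

lemma gchoose_rising_product: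
  fixes \<alpha> :: complex
  shows "(\<alpha> + of_nat k - 1) gchoose k = (\<Prod>i<k. \<alpha> + of_nat i) / fact k"
  by (simp add: gbinomial_pochhammer' pochhammer_prod lessThan_atLeast0)

end

theory Submission
  imports Defs
begin

text \<open>
  Write \<open>T\<^sub>\<alpha> p = \<alpha> x p + (x + x\<^sup>2) p'\<close>. The Stirling recurrence gives
  \<open>T\<^sub>\<alpha> w\<^sub>n = w\<^sub>n\<^sub>+\<^sub>1\<close>, so \<open>w\<^sub>n\<^sub>+\<^sub>m = T\<^sub>\<alpha>\<^sup>n w\<^sub>m\<close> is a combination of the
  \<open>T\<^sub>\<alpha>\<^sup>n x\<^sup>k\<close>. Since \<open>T\<^sub>\<alpha> (x\<^sup>k p) = x\<^sup>k (T\<^bsub>\<alpha>+k\<^esub> + k) p\<close>, expanding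
  \<open>(T\<^bsub>\<alpha>+k\<^esub> + k)\<^sup>n 1\<close> by the binomial theorem gives the inner sum over \<open>j\<close>.
\<close>

definition geometric_op :: "'a::idom \<Rightarrow> 'a poly \<Rightarrow> 'a poly" where
  "geometric_op a p = [:0, a:] * p + [:0, 1, 1:] * pderiv p"

lemma geometric_op_add: "geometric_op a (p + q) = geometric_op a p + geometric_op a q"
  by (simp add: geometric_op_def pderiv_add smult_add_right algebra_simps)

lemma geometric_op_smult: "geometric_op a (smult c p) = smult c (geometric_op a p)"
  by (simp add: geometric_op_def pderiv_smult smult_add_right)

lemma geometric_op_sum: "geometric_op a (\<Sum>i\<in>A. f i) = (\<Sum>i\<in>A. geometric_op a (f i))"
proof (induction A rule: infinite_finite_induct)
  case (insert i A)
  then show ?case by (simp add: geometric_op_add)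
qed (simp_all add: geometric_op_def)

lemma smult_sum_right: "smult c (\<Sum>i\<in>A. f i) = (\<Sum>i\<in>A. smult c (f i))"
  by (induction A rule: infinite_finite_induct) (simp_all add: smult_add_right)

lemma geometric_op_funpow_sum_smult:
  "(geometric_op a ^^ n) (\<Sum>i\<in>A. smult (c i) (f i)) =
     (\<Sum>i\<in>A. smult (c i) ((geometric_op a ^^ n) (f i)))"
  by (induction n) (simp_all add: geometric_op_sum geometric_op_smult)

text \<open>The part \<open>a * x * p\<close> yields \<open>a\<close>, while multiplying
  \<open>pderiv p\<close> by x^2 and by x yields the weights \<open>l\<close> and
  \<open>Suc l\<close>.\<close>

lemma coeff_geometric_op_Suc:
  "coeff (geometric_op a p) (Suc l) =
     (a + of_nat l) * coeff p l + of_nat (Suc l) * coeff p (Suc l)"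
  by (cases l) (simp_all add: geometric_op_def coeff_pderiv algebra_simps)

lemma coeff_geometric_op_0: "coeff (geometric_op a p) 0 = 0"
  by (simp add: geometric_op_def)

text \<open>By the product rule the extra term is (x + x^2) k x^(k-1) p = x^k (k p + k x p): the
  first summand is the added multiple of \<open>p\<close>, the second raises the parameter by
  \<open>k\<close>.\<close>

lemma geometric_op_monom_mult:
  "geometric_op a (monom 1 k * p) =
     monom 1 k * (geometric_op (a + of_nat k) p + smult (of_nat k) p)"
proof (rule poly_eqI)
  fix l
  show "coeff (geometric_op a (monom 1 k * p)) l =
    coeff (monom 1 k * (geometric_op (a + of_nat k) p + smult (of_nat k) p)) l"
  proof (cases l)
    case 0
    then show ?thesis
      by (cases k) (simp_all add: coeff_geometric_op_0 coeff_monom_mult)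
  next
    case (Suc r)
    \<comment> \<open>Below degree \<open>k\<close> both sides vanish; at degree \<open>k\<close>
      only \<open>coeff p 0\<close> survives, with weight \<open>k\<close>; above it the recurrence
      applies at \<open>Suc s\<close>.\<close>
    consider "r < k" "Suc r \<noteq> k" | "k = Suc r" | s where "r = k + s"
      by (metis le_iff_add not_less)
    then show ?thesis
      by cases (simp_all add: Suc coeff_geometric_op_0 coeff_geometric_op_Suc coeff_monom_mult
          Suc_diff_le, auto simp: algebra_simps)
  qed
qed

text \<open>The factorial cancels the denominator of the binomial. No bound on \<open>l\<close> is
  needed, as \<open>Stirling n l\<close> vanishes for l > n.\<close>

lemma coeff_geometric_poly:
  "coeff (geometric_poly n \<alpha>) l = of_nat (Stirling n l) * pochhammer \<alpha> l"
proof -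
  have "coeff (geometric_poly n \<alpha>) l =
      (\<Sum>k=0..n. if k = l then of_nat (Stirling n k) * pochhammer \<alpha> k else 0)"
    by (simp add: geometric_poly_def coeff_sum coeff_monom gbinomial_pochhammer' mult.assoc
        cong: if_cong)
  then show ?thesis
    by (simp add: sum.delta)
qed

lemma geometric_poly_0: "geometric_poly 0 \<alpha> = 1"
  by (simp add: geometric_poly_def)

text \<open>The factor \<open>\<alpha> + of_nat l\<close> extends the rising factorial by one step,
  which leaves exactly the Stirling recurrence.\<close>

lemma geometric_op_geometric_poly:
  "geometric_op \<alpha> (geometric_poly n \<alpha>) = geometric_poly (Suc n) \<alpha>"
proof (rule poly_eqI)
  fix l
  show "coeff (geometric_op \<alpha> (geometric_poly n \<alpha>)) l = coeff (geometric_poly (Suc n) \<alpha>) l"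
    by (cases l)
      (simp_all add: coeff_geometric_op_0 coeff_geometric_op_Suc coeff_geometric_poly
        pochhammer_Suc algebra_simps)
qed

lemma geometric_op_funpow_geometric_poly:
  "(geometric_op \<alpha> ^^ n) (geometric_poly m \<alpha>) = geometric_poly (n + m) \<alpha>"
  by (induction n) (simp_all add: geometric_op_geometric_poly)

text \<open>Pascal's rule, packaged as the induction step for expanding (T + c)^n, with
  \<open>u j\<close> standing for the j-th iterate of T.\<close>

lemma sum_binomial_power_Suc:
  fixes c :: "'a::comm_ring_1" and u :: "nat \<Rightarrow> 'a poly"
  shows "(\<Sum>j\<le>Suc n. smult (of_nat (Suc n choose j) * c ^ (Suc n - j)) (u j)) =
    (\<Sum>j\<le>n. smult (of_nat (n choose j) * c ^ (n - j)) (u (Suc j) + smult c (u j)))"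
    (is "?L = ?R")
proof -
  have shift: "(\<Sum>j\<le>n. smult (of_nat (n choose j) * c ^ (n - j) * c) (u j)) =
      smult (c ^ Suc n) (u 0) +
      (\<Sum>j\<le>n. smult (of_nat (n choose Suc j) * c ^ (n - j)) (u (Suc j)))"
  proof -
    \<comment> \<open>The added term j = \<open>Suc n\<close> is zero because
      \<open>n choose Suc n\<close> is; splitting off j = 0 then shifts the index.\<close>
    have "(\<Sum>j\<le>n. smult (of_nat (n choose j) * c ^ (n - j) * c) (u j)) =
        (\<Sum>j\<le>Suc n. smult (of_nat (n choose j) * c ^ (Suc n - j)) (u j))"
      by (simp add: Suc_diff_le binomial_eq_0 mult_ac)
    then show ?thesis
      by (simp add: sum.atMost_Suc_shift del: sum.atMost_Suc)
  qed
  have "?L = smult (c ^ Suc n) (u 0) +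
      (\<Sum>j\<le>n. smult (of_nat (n choose Suc j) * c ^ (n - j)) (u (Suc j))) +
      (\<Sum>j\<le>n. smult (of_nat (n choose j) * c ^ (n - j)) (u (Suc j)))"
    by (simp add: sum.atMost_Suc_shift sum.distrib smult_add_left distrib_right
        del: sum.atMost_Suc)
  also have "\<dots> = ?R"
    by (simp add: shift smult_add_right sum.distrib)
  finally show ?thesis .
qed

text \<open>Each application passes \<open>monom 1 k\<close> and either raises the index
  \<open>j\<close> or contributes a factor \<open>k\<close>. For k = 0 the convention 0^0 = 1 keeps
  just j = n.\<close>

lemma geometric_op_funpow_monom:
  "(geometric_op \<alpha> ^^ n) (monom 1 k) =
    monom 1 k * (\<Sum>j\<le>n. smult (of_nat (n choose j) * of_nat k ^ (n - j))
      (geometric_poly j (\<alpha> + of_nat k)))"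
proof (induction n)
  case 0
  then show ?case by (simp add: geometric_poly_0)
next
  case (Suc n)
  have "(geometric_op \<alpha> ^^ Suc n) (monom 1 k) =
      monom 1 k * (\<Sum>j\<le>n. smult (of_nat (n choose j) * of_nat k ^ (n - j))
        (geometric_poly (Suc j) (\<alpha> + of_nat k) +
         smult (of_nat k) (geometric_poly j (\<alpha> + of_nat k))))"
    by (simp add: Suc geometric_op_monom_mult geometric_op_sum geometric_op_smult
        geometric_op_geometric_poly smult_add_right sum.distrib smult_sum_right mult_ac)
  then show ?case
    by (simp only: sum_binomial_power_Suc)
qed

theorem theorem8:
  fixes n m :: nat and \<alpha> :: complex
  assumes "Re \<alpha> > 0"
  shows "geometric_poly (n + m) \<alpha> =
    (\<Sum>k=0..m. \<Sum>j=0..n.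
       monom (of_nat (Stirling m k) * of_nat (n choose j) * ((\<alpha> + of_nat k - 1) gchoose k)
              * fact k * of_nat k ^ (n - j)) k
       * geometric_poly j (\<alpha> + of_nat k))"
proof -
  define c where "c k = of_nat (Stirling m k) * ((\<alpha> + of_nat k - 1) gchoose k) * fact k" for k
  have "geometric_poly m \<alpha> = (\<Sum>k=0..m. smult (c k) (monom 1 k))"
    by (simp add: geometric_poly_def c_def smult_monom)
  then have "geometric_poly (n + m) \<alpha> =
      (\<Sum>k=0..m. smult (c k) ((geometric_op \<alpha> ^^ n) (monom 1 k)))"
    by (metis geometric_op_funpow_geometric_poly geometric_op_funpow_sum_smult)
  also have "\<dots> = (\<Sum>k=0..m. \<Sum>j=0..n.
      monom (c k * (of_nat (n choose j) * of_nat k ^ (n - j))) k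
        * geometric_poly j (\<alpha> + of_nat k))"
  proof -
    \<comment> \<open>Separates the weight \<open>c k\<close> from the binomial weight, matching the
      expansion of the iterates on \<open>monom 1 k\<close>.\<close>
    have "monom (a * b) k * p = smult a (monom 1 k * smult b p)" for a b :: complex and k p
      by (metis mult.right_neutral mult_smult_left mult_smult_right smult_monom smult_smult)
    then show ?thesis
      by (simp add: geometric_op_funpow_monom sum_distrib_left smult_sum_right atLeast0AtMost)
  qed
  finally show ?thesis
    by (simp add: c_def mult_ac)
qed

end
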